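(* Let $f:\mathbb E\to\mathbb R\cup\{+\infty\}$ be a proper extended real function, $\bar x\in\mathrm{dom}\,f$, and let $n$ be a positive integer. Then $\bar x$ is an isolated local minimizer of order $n$ of $f$ if and only if $f^{\downarrow}_n(\bar x)>0$.
   Context: $\mathbb E$ is a real finite-dimensional Euclidean space. A proper extended real function is $f:\mathbb E\to\mathbb R\cup\{+\infty\}$ having at least one finite value; $\mathrm{dom}\,f=\{x\mid f(x)<+\infty\}$. Isolated local minimizer of order $n$: a point $\bar x\in\mathrm{dom}\,f$ for which there exist a neighborhood $N$ of $\bar x$ and a constant $C>0$ with $f(x)\ge f(\bar x)+C\|x-\bar x\|^n$ for all $x\in N$. Demyanov's derivative of order $n$ at $x\in\mathrm{dom}\,f$: \[ f^{\downarrow}_n(x)=\liminf_{y\to x,\,y\ne x}\frac{f(y)-f(x)}{\|y-x\|^n}\in[-\infty,+\infty]. \] *)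

theory Defs
  imports "HOL-Analysis.Analysis"
begin

text \<open>Functions with values in the reals extended by plus infinity are represented as
  \<^typ>\<open>ereal\<close>-valued functions; the value minus infinity is excluded by properness.\<close>

definition proper_ereal_fun :: "('a \<Rightarrow> ereal) \<Rightarrow> bool" where
  "proper_ereal_fun f \<longleftrightarrow> (\<forall>x. f x \<noteq> -\<infinity>) \<and> (\<exists>x. f x < \<infinity>)"

definition effective_dom :: "('a \<Rightarrow> ereal) \<Rightarrow> 'a set" where
  "effective_dom f = {x. f x < \<infinity>}"

definition isolated_local_minimizer ::
    "nat \<Rightarrow> ('a::euclidean_space \<Rightarrow> ereal) \<Rightarrow> 'a \<Rightarrow> bool" where
  "isolated_local_minimizer n f xbar \<longleftrightarrow>
     xbar \<in> effective_dom f \<and>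
     (\<exists>N C. xbar \<in> interior N \<and> C > (0::real) \<and>
        (\<forall>x\<in>N. f x \<ge> f xbar + ereal (C * norm (x - xbar) ^ n)))"

text \<open>Meaningful for \<^term>\<open>x \<in> effective_dom f\<close>. The filter \<^term>\<open>at x\<close> is the punctured
  neighbourhood filter, so the denominator is never zero where it matters.\<close>

definition demyanov_deriv ::
    "nat \<Rightarrow> ('a::euclidean_space \<Rightarrow> ereal) \<Rightarrow> 'a \<Rightarrow> ereal" where
  "demyanov_deriv n f x = Liminf (at x) (\<lambda>y. (f y - f x) / ereal (norm (y - x) ^ n))"

end

theory Submission
  imports Defs
begin

text \<open>Away from \<open>xbar\<close> the denominator \<open>norm (y - xbar) ^ n\<close> is a positive real and \<open>f xbar\<close>
  is finite, so dividing by the one and subtracting the other are reversible: a growth estimate with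
  constant \<open>C\<close> at \<open>y\<close> is a lower bound \<open>C\<close> for the difference quotient at \<open>y\<close>
  (\<open>le_ereal_diff_quotient_iff\<close>). At \<open>y = xbar\<close> the growth estimate is trivial, because
  \<open>n > 0\<close> makes the term of order \<open>n\<close> vanish there, so nothing is lost in passing from a full
  to a punctured neighbourhood. Hence \<open>xbar\<close> is an isolated local minimizer of order \<open>n\<close> exactly when
  the quotients are eventually bounded below by some real \<open>C > 0\<close>, that is, when their lower
  limit is positive (\<open>Liminf_pos_iff_eventually_ge_real\<close>).\<close>

lemma le_ereal_diff_quotient_iff:
  fixes a :: ereal and r d C :: real
  assumes "d > 0"
  shows "ereal C \<le> (a - ereal r) / ereal d \<longleftrightarrow> ereal r + ereal (C * d) \<le> a"
  using assms by (cases a) (auto simp: field_simps)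

text \<open>A positive lower limit need not be finite, and it need not itself be an eventual lower bound;
  both defects are removed by stepping down to a real strictly between it and zero.\<close>

lemma Liminf_pos_iff_eventually_ge_real:
  fixes g :: "'a \<Rightarrow> ereal"
  shows "0 < Liminf F g \<longleftrightarrow> (\<exists>C>0::real. \<forall>\<^sub>F y in F. ereal C \<le> g y)"
proof
  assume "0 < Liminf F g"
  then obtain C where "0 < ereal C" "ereal C < Liminf F g"
    using ereal_dense2 by blast
  then have "\<forall>\<^sub>F y in F. ereal C < g y"
    by (auto dest: less_LiminfD)
  then have "\<forall>\<^sub>F y in F. ereal C \<le> g y"
    by (rule eventually_mono) simp
  with \<open>0 < ereal C\<close> show "\<exists>C>0. \<forall>\<^sub>F y in F. ereal C \<le> g y"
    by (intro exI[of _ C]) simp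
next
  assume "\<exists>C>0. \<forall>\<^sub>F y in F. ereal C \<le> g y"
  then obtain C :: real where "C > 0" "ereal C \<le> Liminf F g"
    using Liminf_bounded by blast
  then show "0 < Liminf F g"
    by (meson ereal_less(2) less_le_trans)
qed

lemma ex_neighbourhood_iff_eventually_nhds:
  "(\<exists>N. x \<in> interior N \<and> (\<forall>y\<in>N. P y)) \<longleftrightarrow> eventually P (nhds x)"
  unfolding eventually_nhds interior_def by blast

theorem proposition5p5:
  fixes f :: "'a::euclidean_space \<Rightarrow> ereal" and xbar :: 'a and n :: nat
  assumes "proper_ereal_fun f"
    and "xbar \<in> effective_dom f"
    and "n > 0"
  shows "isolated_local_minimizer n f xbar \<longleftrightarrow> demyanov_deriv n f xbar > 0"
proof -
  from assms(1,2) obtain r where r: "f xbar = ereal r"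
    by (cases "f xbar") (auto simp: proper_ereal_fun_def effective_dom_def)
  define growth where
    "growth C y \<longleftrightarrow> f xbar + ereal (C * norm (y - xbar) ^ n) \<le> f y" for C y
  define quotient where
    "quotient y = (f y - f xbar) / ereal (norm (y - xbar) ^ n)" for y
  have growth_iff: "growth C y \<longleftrightarrow> ereal C \<le> quotient y" if "y \<noteq> xbar" for C y
    using that by (simp add: growth_def quotient_def r le_ereal_diff_quotient_iff)
  have growth_at_xbar: "growth C xbar" for C
    using assms(3) by (simp add: growth_def r power_0_left)
  have "isolated_local_minimizer n f xbar \<longleftrightarrow> (\<exists>C>0. eventually (growth C) (nhds xbar))"
    using assms(2)
    unfolding isolated_local_minimizer_def growth_def
      ex_neighbourhood_iff_eventually_nhds[symmetric] by blast
  also have "\<dots> \<longleftrightarrow> (\<exists>C>0. \<forall>\<^sub>F y in at xbar. ereal C \<le> quotient y)"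
  proof -
    have "eventually (growth C) (nhds xbar) \<longleftrightarrow> (\<forall>\<^sub>F y in at xbar. ereal C \<le> quotient y)" for C
      unfolding eventually_at_filter
      by (rule eventually_cong[OF eventually_True]) (metis UNIV_I growth_iff growth_at_xbar)
    then show ?thesis by simp
  qed
  also have "\<dots> \<longleftrightarrow> demyanov_deriv n f xbar > 0"
    by (simp add: demyanov_deriv_def quotient_def Liminf_pos_iff_eventually_ge_real)
  finally show ?thesis .
qed

end
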